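(* Let $G$ be a finite connected graph. Then $c(G) \leq \alpha(G)- \left\lfloor \frac{D(G)-3}{2} \right\rfloor$, where $c(G)$ is the cop number, $\alpha(G)$ the independence number and $D(G)$ the diameter of $G$.
   Context: The game of Cops and Robbers on a finite undirected graph $G$: one player controls $k$ cops and the other a single robber. First the cops choose starting vertices (several cops may share a vertex), then the robber chooses a starting vertex. Players then alternate turns, beginning with the cops; on the cops' turn each cop moves to a vertex at distance at most $1$ from its current vertex, and on the robber's turn the robber does likewise. The cops win if at some point the robber occupies the same vertex as some cop; otherwise the robber wins. The cop number $c(G)$ is the minimum $k$ such that $k$ cops have a winning strategy. $\alpha(G)$ is the maximum size of an independent set of $G$, and $D(G)$ is the maximum distance between two vertices of $G$. *)

theory Defs
  imports "Graph_Theory.Graph_Theory"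
begin

text \<open>
  Distances are the shortest-path costs for unit arc weights, hence of type \<^typ>\<open>ereal\<close>, with value
  \<open>\<infinity>\<close> between vertices that are not joined by a walk. On a finite connected graph the
  diameter is a finite maximum of finite values.
\<close>

definition graph_dist :: "('a, 'b) pre_digraph \<Rightarrow> 'a \<Rightarrow> 'a \<Rightarrow> ereal" where
  "graph_dist G u v = wf_digraph.\<mu> G (\<lambda>_. 1) u v"

definition graph_diameter :: "('a, 'b) pre_digraph \<Rightarrow> ereal" where
  "graph_diameter G = Max {graph_dist G u v | u v. u \<in> verts G \<and> v \<in> verts G}"

definition independent_set :: "('a, 'b) pre_digraph \<Rightarrow> 'a set \<Rightarrow> bool" where
  "independent_set G S \<longleftrightarrow> S \<subseteq> verts G \<and> (\<forall>u\<in>S. \<forall>v\<in>S. \<not> u \<rightarrow>\<^bsub>G\<^esub> v)"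

definition independence_number :: "('a, 'b) pre_digraph \<Rightarrow> nat" where
  "independence_number G = Max {card S | S. independent_set G S}"

definition legal_move :: "('a, 'b) pre_digraph \<Rightarrow> 'a \<Rightarrow> 'a \<Rightarrow> bool" where
  "legal_move G u v \<longleftrightarrow> u \<in> verts G \<and> v \<in> verts G \<and> graph_dist G u v \<le> 1"

text \<open>
  The robber's play is the sequence \<open>r 0, r 1, \<dots>\<close> of its positions, \<open>r 0\<close> being the starting
  vertex. A strategy of the cops maps the finite sequence of all robber positions seen so far to
  the list of the cops' positions: \<open>\<sigma> []\<close> is the initial placement, chosen before the robber's,
  and \<open>\<sigma> [r 0, \<dots>, r t]\<close> is the placement after the cops have answered the robber's arrival
  at \<open>r t\<close>. The cops' own earlier positions are determined by this sequence, so \<open>\<sigma>\<close> may depend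
  on the entire history of the game. Plays are continued after a capture, which does not affect
  who wins.
\<close>

definition robber_play :: "('a, 'b) pre_digraph \<Rightarrow> (nat \<Rightarrow> 'a) \<Rightarrow> bool" where
  "robber_play G r \<longleftrightarrow> r 0 \<in> verts G \<and> (\<forall>t. legal_move G (r t) (r (Suc t)))"

definition cop_strategy :: "('a, 'b) pre_digraph \<Rightarrow> nat \<Rightarrow> ('a list \<Rightarrow> 'a list) \<Rightarrow> bool" where
  "cop_strategy G k \<sigma> \<longleftrightarrow>
     length (\<sigma> []) = k \<and> set (\<sigma> []) \<subseteq> verts G \<and>
     (\<forall>r t. robber_play G r \<longrightarrow>
        list_all2 (legal_move G) (\<sigma> (map r [0..<t])) (\<sigma> (map r [0..<Suc t])))"

text \<open>
  The robber at \<open>r t\<close> can be caught either because it chose a vertex occupied by a cop or by the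
  cops' answer.
\<close>

definition captured :: "('a list \<Rightarrow> 'a list) \<Rightarrow> (nat \<Rightarrow> 'a) \<Rightarrow> nat \<Rightarrow> bool" where
  "captured \<sigma> r t \<longleftrightarrow> r t \<in> set (\<sigma> (map r [0..<t])) \<or> r t \<in> set (\<sigma> (map r [0..<Suc t]))"

definition cops_win :: "('a, 'b) pre_digraph \<Rightarrow> nat \<Rightarrow> bool" where
  "cops_win G k \<longleftrightarrow>
     (\<exists>\<sigma>. cop_strategy G k \<sigma> \<and> (\<forall>r. robber_play G r \<longrightarrow> (\<exists>t. captured \<sigma> r t)))"

definition cop_number :: "('a, 'b) pre_digraph \<Rightarrow> nat" where
  "cop_number G = (LEAST k. cops_win G k)"

lemma (in wf_digraph) awalk_cost_unit: "awalk_cost (\<lambda>_. 1) p = real (length p)"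
  by (induct p) auto

lemma (in wf_digraph) graph_dist_least:
  assumes "u \<rightarrow>\<^sup>* v"
  shows "graph_dist G u v = ereal (real (LEAST n. \<exists>p. awalk u p v \<and> length p = n))"
    (is "_ = ereal (real ?n)")
proof -
  have "\<exists>n p. awalk u p v \<and> length p = n"
    using assms by (auto simp: reachable_awalk)
  from LeastI_ex[OF this] obtain p where p: "awalk u p v" "length p = ?n" by blast
  have le: "?n \<le> length q" if "awalk u q v" for q
    by (rule Least_le) (use that in blast)
  show ?thesis
    unfolding graph_dist_def \<mu>_def awalk_cost_unit
    by (rule antisym) (use p le in \<open>auto intro!: INF_lower2[of p] INF_greatest\<close>)
qed

lemma (in wf_digraph) graph_dist_self:
  assumes "u \<in> verts G"
  shows "graph_dist G u u = 0"
proof -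
  have "(LEAST n. \<exists>p. awalk u p u \<and> length p = n) = 0"
    by (rule Least_equality) (use assms in \<open>auto simp: awalk_Nil_iff\<close>)
  then show ?thesis using graph_dist_least[of u u] assms by (simp add: zero_ereal_def)
qed

lemma (in wf_digraph) legal_move_iff:
  "legal_move G u v \<longleftrightarrow> u \<in> verts G \<and> v \<in> verts G \<and> (u = v \<or> u \<rightarrow> v)"
proof (cases "u \<in> verts G \<and> v \<in> verts G")
  case uv: True
  show ?thesis
  proof
    assume m: "legal_move G u v"
    then have d: "graph_dist G u v \<le> 1" by (simp add: legal_move_def)
    have reach: "u \<rightarrow>\<^sup>* v"
    proof (rule ccontr)
      assume "\<not> u \<rightarrow>\<^sup>* v"
      from shortest_path_inf[OF this] d show False by (simp add: graph_dist_def)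
    qed
    let ?n = "LEAST n. \<exists>p. awalk u p v \<and> length p = n"
    have "\<exists>n p. awalk u p v \<and> length p = n"
      using reach by (auto simp: reachable_awalk)
    from LeastI_ex[OF this] obtain p where p: "awalk u p v" "length p = ?n" by blast
    have "?n \<le> 1" using d graph_dist_least[OF reach] by (simp add: one_ereal_def)
    with p have "length p \<le> 1" by simp
    with p(1) show "u \<in> verts G \<and> v \<in> verts G \<and> (u = v \<or> u \<rightarrow> v)"
      using uv by (cases p) (auto simp: awalk_Cons_iff awalk_Nil_iff arcs_ends_conv)
  next
    assume r: "u \<in> verts G \<and> v \<in> verts G \<and> (u = v \<or> u \<rightarrow> v)"
    then consider "u = v" | e where "e \<in> arcs G" "tail G e = u" "head G e = v" by auto
    then show "legal_move G u v"
    proof cases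
      case 1
      then show ?thesis using uv by (simp add: legal_move_def graph_dist_self)
    next
      case 2
      then have "awalk u [e] v" by (auto simp: awalk_Cons_iff awalk_Nil_iff)
      from min_cost_le_walk_cost[OF this, of "\<lambda>_. 1"] show ?thesis
        using uv by (simp add: legal_move_def graph_dist_def awalk_cost_unit one_ereal_def)
    qed
  qed
qed (auto simp: legal_move_def)

lemma (in fin_digraph) cops_win_card: "cops_win G (card (verts G))"
proof -
  obtain xs where xs: "set xs = verts G" "distinct xs"
    using finite_distinct_list[OF finite_verts] by blast
  have "cop_strategy G (card (verts G)) (\<lambda>_. xs)"
    using xs distinct_card[OF xs(2)]
    by (auto simp: cop_strategy_def legal_move_iff intro!: list.rel_refl_strong)
  moreover have "captured (\<lambda>_. xs) r 0" if "robber_play G r" for r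
    using that xs by (auto simp: captured_def robber_play_def)
  ultimately show ?thesis unfolding cops_win_def by blast
qed

end

theory Submission
  imports Defs
begin

text \<open>
  Layer \<open>G\<close> by the distance from an end of a diametral pair, and let \<open>I\<close> be a maximal independent
  set containing a vertex from every even layer (such vertices are pairwise non-adjacent). Layer
  \<open>j\<close> is dominated by the vertices of \<open>I\<close> in the layers \<open>j - 1, j, j + 1\<close>, so cops standing there
  stop the robber from crossing it. While they wait, the other cops walk to the vertices of \<open>I\<close> in
  layer \<open>j + 2\<close>; then layer \<open>j + 1\<close> is guarded as well and the vertices in layer \<open>j - 1\<close> can be
  released. Sweeping through all layers in this way catches the robber, and needs only as many cops
  as \<open>I\<close> has vertices in four consecutive layers. Such a window misses all but two of the
  \<open>\<lfloor>D / 2\<rfloor> + 1\<close> even layers, hence at least \<open>\<lfloor>D / 2\<rfloor> - 1\<close> vertices of \<open>I\<close>.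
\<close>

section \<open>Finite-horizon wins\<close>

text \<open>It is the cops' turn in the position \<open>C\<close>, \<open>r\<close>.\<close>

fun cops_win_in :: "('a, 'b) pre_digraph \<Rightarrow> nat \<Rightarrow> 'a list \<Rightarrow> 'a \<Rightarrow> bool" where
  "cops_win_in G 0 C r \<longleftrightarrow> False"
| "cops_win_in G (Suc n) C r \<longleftrightarrow> (\<exists>C'. list_all2 (legal_move G) C C' \<and>
     (r \<in> set C' \<or> (\<forall>r'. legal_move G r r' \<longrightarrow> cops_win_in G n C' r')))"

definition cops_win_from :: "('a, 'b) pre_digraph \<Rightarrow> 'a list \<Rightarrow> 'a \<Rightarrow> bool" where
  "cops_win_from G C r \<longleftrightarrow> (\<exists>n. cops_win_in G n C r)"

lemma cops_win_in_Suc: "cops_win_in G n C r \<Longrightarrow> cops_win_in G (Suc n) C r"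
proof (induction n arbitrary: C r)
  case (Suc n)
  from Suc.prems obtain C' where "list_all2 (legal_move G) C C'"
    and "r \<in> set C' \<or> (\<forall>r'. legal_move G r r' \<longrightarrow> cops_win_in G n C' r')" by auto
  with Suc.IH show ?case by (subst cops_win_in.simps) blast
qed simp

lemma cops_win_in_mono: "cops_win_in G n C r \<Longrightarrow> n \<le> m \<Longrightarrow> cops_win_in G m C r"
  by (rule lift_Suc_mono_le[where f = "\<lambda>n. cops_win_in G n C r", THEN le_boolD, rule_format])
     (auto intro: cops_win_in_Suc simp del: cops_win_in.simps)

lemma cops_win_from_capture:
  assumes "list_all2 (legal_move G) C C'" "r \<in> set C'"
  shows "cops_win_from G C r"
  using assms unfolding cops_win_from_def by (intro exI[of _ "Suc 0"]) auto

text \<open>The horizon may depend on the robber's reply. As there are finitely many replies, one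
  horizon serves them all.\<close>

lemma cops_win_from_step:
  assumes fin: "finite (verts G)"
    and C': "list_all2 (legal_move G) C C'"
    and win: "\<And>r'. legal_move G r r' \<Longrightarrow> cops_win_from G C' r'"
  shows "cops_win_from G C r"
proof -
  obtain f where f: "\<And>r'. legal_move G r r' \<Longrightarrow> cops_win_in G (f r') C' r'"
    using win unfolding cops_win_from_def by metis
  \<comment> \<open>A sum of naturals dominates each summand; the arbitrary values of
    \<open>f\<close> at illegal replies only enlarge it.\<close>
  have "cops_win_in G (\<Sum>v\<in>verts G. f v) C' r'" if "legal_move G r r'" for r'
  proof (rule cops_win_in_mono[OF f[OF that]])
    show "f r' \<le> (\<Sum>v\<in>verts G. f v)"
      using that fin by (intro member_le_sum) (auto simp: legal_move_def)
  qed
  with C' have "cops_win_in G (Suc (\<Sum>v\<in>verts G. f v)) C r" by auto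
  then show ?thesis unfolding cops_win_from_def by blast
qed

lemma list_all2_legal_move_verts: "list_all2 (legal_move G) C C' \<Longrightarrow> set C' \<subseteq> verts G"
  by (auto simp: list_all2_conv_all_nth in_set_conv_nth legal_move_def)

text \<open>The positional strategy that always decreases the optimal horizon.\<close>

definition cop_step :: "('a, 'b) pre_digraph \<Rightarrow> 'a list \<Rightarrow> 'a \<Rightarrow> 'a list" where
  "cop_step G C r = (if cops_win_from G C r
     then SOME C'. list_all2 (legal_move G) C C' \<and> (r \<in> set C' \<or>
       (\<forall>r'. legal_move G r r' \<longrightarrow> cops_win_in G ((LEAST n. cops_win_in G n C r) - 1) C' r'))
     else C)"

lemma cop_step_decreases:
  assumes "cops_win_in G n C r"
  shows "list_all2 (legal_move G) C (cop_step G C r)"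
    and "r \<in> set (cop_step G C r) \<or>
      (\<exists>m<n. \<forall>r'. legal_move G r r' \<longrightarrow> cops_win_in G m (cop_step G C r) r')"
proof -
  define l where "l = (LEAST n. cops_win_in G n C r)"
  have l: "cops_win_in G l C r" unfolding l_def using assms by (rule LeastI)
  have ln: "l \<le> n" unfolding l_def using assms by (rule Least_le)
  \<comment> \<open>Horizon 0 is never winning, so the truncated \<open>l - 1\<close> is a true
    predecessor.\<close>
  obtain l' where l': "l = Suc l'" using l by (cases l) auto
  have "\<exists>C'. list_all2 (legal_move G) C C' \<and>
      (r \<in> set C' \<or> (\<forall>r'. legal_move G r r' \<longrightarrow> cops_win_in G (l - 1) C' r'))"
    using l by (simp add: l')
  from someI_ex[OF this] have *: "list_all2 (legal_move G) C (cop_step G C r) \<and>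
      (r \<in> set (cop_step G C r) \<or>
        (\<forall>r'. legal_move G r r' \<longrightarrow> cops_win_in G (l - 1) (cop_step G C r) r'))"
    using assms by (auto simp: cop_step_def cops_win_from_def l_def)
  then show "list_all2 (legal_move G) C (cop_step G C r)" by blast
  have "l - 1 < n" using ln l' by simp
  with * show "r \<in> set (cop_step G C r) \<or>
      (\<exists>m<n. \<forall>r'. legal_move G r r' \<longrightarrow> cops_win_in G m (cop_step G C r) r')" by blast
qed

context wf_digraph
begin

lemma legal_move_refl: "v \<in> verts G \<Longrightarrow> legal_move G v v"
  by (simp add: legal_move_iff)

lemma list_all2_legal_move_refl:
  "set C \<subseteq> verts G \<Longrightarrow> list_all2 (legal_move G) C C"
  by (auto simp: legal_move_refl intro!: list.rel_refl_strong)

lemma list_all2_legal_move_update: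
  assumes "set C \<subseteq> verts G" "i < length C" "legal_move G (C ! i) v"
  shows "list_all2 (legal_move G) C (C[i := v])"
  using assms by (auto simp: list_all2_conv_all_nth nth_list_update legal_move_refl subset_iff)

text \<open>Since \<open>cop_step\<close> is positional, folding it over the robber's history
  recovers the cops' placement. The available horizon drops every round until a capture
  occurs.\<close>

lemma cops_win_if_win_from:
  assumes C0: "set C0 \<subseteq> verts G"
    and win: "\<And>r. r \<in> verts G \<Longrightarrow> cops_win_from G C0 r"
  shows "cops_win G (length C0)"
proof -
  define \<sigma> where "\<sigma> = foldl (cop_step G) C0"
  have \<sigma>_Suc: "\<sigma> (map r [0..<Suc t]) = cop_step G (\<sigma> (map r [0..<t])) (r t)" for r t
    by (simp add: \<sigma>_def)
  \<comment> \<open>A strategy must answer legally even in positions that are not won; there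
    \<open>cop_step\<close> keeps the cops still.\<close>
  have step: "list_all2 (legal_move G) C (cop_step G C r)" if "set C \<subseteq> verts G" for C r
  proof (cases "cops_win_from G C r")
    case True
    then obtain n where "cops_win_in G n C r" unfolding cops_win_from_def ..
    then show ?thesis by (rule cop_step_decreases(1))
  next
    case False
    then show ?thesis using that by (simp add: cop_step_def list_all2_legal_move_refl)
  qed
  have \<sigma>_verts: "set (\<sigma> (map r [0..<t])) \<subseteq> verts G" for r t
  proof (induction t)
    case 0
    then show ?case using C0 by (simp add: \<sigma>_def)
  next
    case (Suc t)
    then show ?case unfolding \<sigma>_Suc by (rule list_all2_legal_move_verts[OF step])
  qed
  have "cop_strategy G (length C0) \<sigma>"
    unfolding cop_strategy_def \<sigma>_Suc using step \<sigma>_verts C0 by (auto simp: \<sigma>_def)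
  moreover have "\<exists>t. captured \<sigma> r t" if r: "robber_play G r" for r
  proof -
    have "\<exists>t. captured \<sigma> r t" if "cops_win_in G n (\<sigma> (map r [0..<t])) (r t)" for n t
      using that
    proof (induction n arbitrary: t rule: less_induct)
      case (less n)
      from cop_step_decreases(2)[OF less.prems] show ?case
      proof
        assume "r t \<in> set (cop_step G (\<sigma> (map r [0..<t])) (r t))"
        then have "captured \<sigma> r t" unfolding captured_def \<sigma>_Suc by blast
        then show ?thesis ..
      next
        assume "\<exists>m<n. \<forall>r'. legal_move G (r t) r' \<longrightarrow>
          cops_win_in G m (cop_step G (\<sigma> (map r [0..<t])) (r t)) r'"
        then obtain m where "m < n" and "cops_win_in G m (\<sigma> (map r [0..<Suc t])) (r (Suc t))"
          using r unfolding robber_play_def \<sigma>_Suc by blast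
        then show ?thesis by (rule less.IH)
      qed
    qed
    moreover have "cops_win_from G (\<sigma> (map r [0..<0])) (r 0)"
      using win r by (simp add: \<sigma>_def robber_play_def)
    ultimately show ?thesis unfolding cops_win_from_def by blast
  qed
  ultimately show ?thesis unfolding cops_win_def by blast
qed

end

section \<open>Confining the robber\<close>

text \<open>\<open>A\<close> is a set of posts held by cops and \<open>S\<close> the robber's
  territory: a robber able to leave \<open>S\<close> stands within reach of a post and is caught
  before it moves.\<close>

definition confines :: "('a, 'b) pre_digraph \<Rightarrow> 'a set \<Rightarrow> 'a set \<Rightarrow> bool" where
  "confines G A S \<longleftrightarrow> S \<subseteq> verts G \<and> (\<forall>r\<in>S. (\<exists>a\<in>A. legal_move G a r) \<or>
     (\<forall>r'. legal_move G r r' \<longrightarrow> r' \<in> S))"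

lemma confines_mono: "confines G A S \<Longrightarrow> A \<subseteq> B \<Longrightarrow> confines G B S"
  unfolding confines_def by blast

text \<open>Pigeonhole: some cop can leave while the others still occupy \<open>A\<close>, either
  one standing outside \<open>A\<close> or one of two sharing a vertex.\<close>

lemma spare_index:
  assumes "A \<subseteq> set C" "card A < length C"
  obtains i where "i < length C" "A \<subseteq> (!) C ` ({..<length C} - {i})"
proof (cases "distinct C")
  case True
  then have "card (set C) = length C" by (rule distinct_card)
  with assms have "\<not> set C \<subseteq> A" using card_mono[of A "set C"] finite_subset[OF assms(1)] by auto
  then obtain x where "x \<in> set C" "x \<notin> A" by blast
  then obtain i where i: "i < length C" "C ! i \<notin> A" by (metis in_set_conv_nth)
  then have "A \<subseteq> (!) C ` ({..<length C} - {i})"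
    using assms(1) by (fastforce simp: in_set_conv_nth subset_iff image_iff)
  with i(1) show thesis by (rule that)
next
  case False
  then obtain i j where ij: "i < length C" "j < length C" "i \<noteq> j" "C ! i = C ! j"
    by (auto simp: distinct_conv_nth)
  have "A \<subseteq> (!) C ` ({..<length C} - {i})"
  proof
    fix x assume "x \<in> A"
    then obtain m where m: "m < length C" "x = C ! m" using assms(1) by (metis in_set_conv_nth subsetD)
    show "x \<in> (!) C ` ({..<length C} - {i})"
    proof (cases "m = i")
      case True
      then show ?thesis using ij m by (intro image_eqI[of _ _ j]) auto
    next
      case False
      then show ?thesis using m by auto
    qed
  qed
  with ij(1) show thesis by (rule that)
qed

context fin_digraph
begin

lemma cops_win_from_dominated:
  assumes "set C \<subseteq> verts G" "a \<in> set C" "legal_move G a r"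
  shows "cops_win_from G C r"
proof -
  obtain i where "i < length C" "C ! i = a" using assms(2) by (auto simp: in_set_conv_nth)
  with assms show ?thesis
    by (intro cops_win_from_capture[OF list_all2_legal_move_update[of C i r]])
       (auto intro: set_update_memI)
qed

text \<open>Cop \<open>i\<close> walks along \<open>p\<close> to \<open>b\<close> while the others
  hold \<open>A\<close>. Before each step the robber is either caught from a post or unable to leave
  \<open>S\<close>, so the territory survives the walk.\<close>

lemma cops_win_from_walk:
  assumes "awalk (C ! i) p b"
    and "set C \<subseteq> verts G" "i < length C"
    and "A \<subseteq> (!) C ` ({..<length C} - {i})"
    and conf: "confines G A S"
    and win: "\<And>C' r. \<lbrakk>length C' = length C; set C' \<subseteq> verts G; insert b A \<subseteq> set C'; r \<in> S\<rbrakk>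
      \<Longrightarrow> cops_win_from G C' r"
    and "r \<in> S"
  shows "cops_win_from G C r"
  using assms(1-4,7) win
proof (induction p arbitrary: C r)
  case Nil
  then have "b \<in> set C" by (auto simp: awalk_Nil_iff)
  moreover have "A \<subseteq> set C" using Nil.prems(4) by auto
  ultimately show ?case using Nil.prems by blast
next
  case (Cons e p)
  let ?C = "C[i := head G e]"
  have A: "A \<subseteq> set C" using Cons.prems(4) by auto
  from Cons.prems(1) have e: "e \<in> arcs G" "tail G e = C ! i" "awalk (head G e) p b"
    by (auto simp: awalk_Cons_iff)
  have "tail G e \<rightarrow> head G e" using e(1) by (simp add: arcs_ends_conv)
  then have lm: "legal_move G (C ! i) (head G e)"
    unfolding legal_move_iff e(2)[symmetric] using e(1) by simp
  then have hv: "head G e \<in> verts G" by (simp add: legal_move_def)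
  consider a where "a \<in> A" "legal_move G a r" | "\<And>r'. legal_move G r r' \<Longrightarrow> r' \<in> S"
    using conf Cons.prems(5) unfolding confines_def by blast
  then show ?case
  proof cases
    case 1
    then show ?thesis using A Cons.prems(2) by (blast intro: cops_win_from_dominated)
  next
    case 2
    show ?thesis
    proof (rule cops_win_from_step)
      show "list_all2 (legal_move G) C ?C"
        using Cons.prems lm by (intro list_all2_legal_move_update) auto
    next
      fix r' assume "legal_move G r r'"
      then have r': "r' \<in> S" by (rule 2)
      have walk: "awalk (?C ! i) p b" and i: "i < length ?C"
        using e(3) Cons.prems(3) by simp_all
      have A': "A \<subseteq> (!) ?C ` ({..<length ?C} - {i})"
        using Cons.prems(4) by (auto simp: image_iff subset_iff)
      have vs: "set ?C \<subseteq> verts G"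
        using Cons.prems(2) hv set_update_subset_insert[of C i "head G e"] by auto
      show "cops_win_from G ?C r'"
        by (rule Cons.IH[OF walk vs i A' r']) (rule Cons.prems(6), simp_all)
    qed simp
  qed
qed

text \<open>The vertices of \<open>B\<close> are occupied one at a time, each then joining the held
  posts. Thus \<open>A\<close> grows in the induction while the union that bounds the number of cops
  stays fixed.\<close>

lemma cops_win_from_summon:
  assumes sc: "strongly_connected G"
    and "finite B" "B \<subseteq> verts G"
    and "set C \<subseteq> verts G" "A \<subseteq> set C" "card (A \<union> B) \<le> length C"
    and "confines G A S"
    and win: "\<And>C' r. \<lbrakk>length C' = length C; set C' \<subseteq> verts G; A \<union> B \<subseteq> set C'; r \<in> S\<rbrakk>
      \<Longrightarrow> cops_win_from G C' r"
    and "r \<in> S"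
  shows "cops_win_from G C r"
  using assms(2-9)
proof (induction B arbitrary: A C r rule: finite_induct)
  case empty
  then show ?case by simp
next
  case (insert b B)
  have finA: "finite A" using insert.prems(3) finite_subset by blast
  have rest: "cops_win_from G C' r'"
    if "length C' = length C" "set C' \<subseteq> verts G" "insert b A \<subseteq> set C'" "r' \<in> S" for C' r'
    using that insert.prems
    by (intro insert.IH[of C' "insert b A" r']) (auto intro: confines_mono)
  show ?case
  proof (cases "b \<in> A")
    case True
    then show ?thesis using insert.prems by (intro rest) auto
  next
    case False
    \<comment> \<open>The missing vertex \<open>b\<close> makes the inequality strict, which yields
      a spare cop.\<close>
    have "card A < card (A \<union> insert b B)"
      using False finA insert.hyps(1) by (intro psubset_card_mono) auto
    also have "\<dots> \<le> length C" by (rule insert.prems(4))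
    finally have "card A < length C" .
    with insert.prems(3) obtain i
      where i: "i < length C" "A \<subseteq> (!) C ` ({..<length C} - {i})" by (rule spare_index)
    then have "C ! i \<in> verts G" using insert.prems(2) nth_mem by blast
    then have "C ! i \<rightarrow>\<^sup>* b" using sc insert.prems(1) by (auto elim: strongly_connectedE)
    then obtain p where "awalk (C ! i) p b" by (auto simp: reachable_awalk)
    then show ?thesis using i insert.prems rest by (intro cops_win_from_walk[of C i p b A S r]) auto
  qed
qed

end

section \<open>Sweeping through the layers\<close>

context pseudo_graph
begin

lemma cops_win_sweep:
  fixes f :: "'a \<Rightarrow> nat"
  assumes sc: "strongly_connected G"
    and layer: "\<And>u v. u \<rightarrow> v \<Longrightarrow> f v \<le> Suc (f u)"
    and I: "I \<subseteq> verts G"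
    and dom: "\<And>v. v \<in> verts G \<Longrightarrow> \<exists>a\<in>I. legal_move G a v"
    and card: "\<And>j. card {x \<in> I. j \<le> f x \<and> f x \<le> j + 3} \<le> k"
  shows "cops_win G k"
proof -
  define D where "D = Max (f ` verts G)"
  have f_le: "f v \<le> D" if "v \<in> verts G" for v
    unfolding D_def using that by (intro Max_ge) auto
  \<comment> \<open>Symmetry of the arcs turns the one-sided layer condition into a two-sided
    one.\<close>
  have lm: "f u \<le> Suc (f v) \<and> f v \<le> Suc (f u)" if "legal_move G u v" for u v
  proof (cases "u = v")
    case False
    then have "u \<rightarrow> v" using that by (simp add: legal_move_iff)
    moreover from this have "v \<rightarrow> u" using sym_arcs unfolding symmetric_def by (rule symD[rotated])
    ultimately show ?thesis using layer by blast
  qed simp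
  have finI: "finite I" using I finite_verts finite_subset by blast
  \<comment> \<open>These are the vertices of \<open>I\<close> in layers \<open>j - 1\<close> to
    \<open>j + 1\<close>, written without subtraction so that \<open>j = 0\<close> needs no separate
    case.\<close>
  define A where "A j = {x \<in> I. j \<le> f x + 1 \<and> f x \<le> j + 1}" for j
  define S where "S j = {x \<in> verts G. j \<le> f x}" for j
  have A_dom: "\<exists>a\<in>A j. legal_move G a r" if r: "r \<in> verts G" "f r = j" for r j
  proof -
    obtain a where a: "a \<in> I" "legal_move G a r" using dom[OF r(1)] by blast
    with lm[OF a(2)] r(2) have "a \<in> A j" by (simp add: A_def)
    with a(2) show ?thesis ..
  qed
  have conf: "confines G (A j) (S j)" for j
    unfolding confines_def
  proof (intro conjI ballI)
    fix r assume r: "r \<in> S j"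
    show "(\<exists>a\<in>A j. legal_move G a r) \<or> (\<forall>r'. legal_move G r r' \<longrightarrow> r' \<in> S j)"
    proof (cases "f r = j")
      case True
      then show ?thesis using A_dom r by (auto simp: S_def)
    next
      case False
      have "r' \<in> S j" if "legal_move G r r'" for r'
        using that lm[OF that] False r by (simp add: S_def legal_move_def)
      then show ?thesis by blast
    qed
  qed (auto simp: S_def)
  have sweep: "cops_win_from G C r"
    if "length C = k" "set C \<subseteq> verts G" "A j \<subseteq> set C" "r \<in> S j" for C r j
    using that
  \<comment> \<open>The base case has \<open>j > D\<close>, where the territory \<open>S j\<close>
    is empty.\<close>
  proof (induction "Suc D - j" arbitrary: C r j)
    case 0
    then show ?case using f_le[of r] by (auto simp: S_def)
  next
    case (Suc m)
    define B where "B = {x \<in> I. f x = j + 2}"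
    \<comment> \<open>For \<open>j = 0\<close> truncation gives the window of layers 0 to 3, which
      still contains layers 0 to 2.\<close>
    have AB: "A j \<union> B \<subseteq> {x \<in> I. j - 1 \<le> f x \<and> f x \<le> (j - 1) + 3}"
      by (auto simp: A_def B_def)
    have "card (A j \<union> B) \<le> k"
      using card_mono[OF _ AB] card[of "j - 1"] finI by (auto intro: order_trans)
    then show ?case
    proof (intro cops_win_from_summon[of B C "A j" "S j" r])
      fix C' r' assume C': "length C' = length C" "set C' \<subseteq> verts G" "A j \<union> B \<subseteq> set C'"
        and r': "r' \<in> S j"
      show "cops_win_from G C' r'"
      \<comment> \<open>A robber in layer \<open>j\<close> is caught at once. Otherwise it lies in
        \<open>S (Suc j)\<close>, whose posts \<open>A (Suc j)\<close> are all occupied.\<close>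
      proof (cases "f r' = j")
        case True
        then obtain a where "a \<in> A j" "legal_move G a r'"
          using A_dom[of r' j] r' by (auto simp: S_def)
        then show ?thesis using C' by (blast intro: cops_win_from_dominated)
      next
        case False
        have "A (Suc j) \<subseteq> A j \<union> B" by (auto simp: A_def B_def)
        then show ?thesis
          using Suc.hyps(2) Suc.prems C' r' False by (intro Suc.hyps(1)[of "Suc j"]) (auto simp: S_def)
      qed
    qed (use sc finI I conf Suc.prems in \<open>auto simp: B_def\<close>)
  qed
  obtain v0 where v0: "v0 \<in> verts G" using sc by (auto simp: strongly_connected_def)
  have "card (A 0) \<le> card {x \<in> I. 0 \<le> f x \<and> f x \<le> 0 + 3}"
    using finI by (intro card_mono) (auto simp: A_def)
  with card[of 0] have A0: "card (A 0) \<le> k" by (rule order_trans[rotated])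
  obtain xs where xs: "set xs = A 0" "distinct xs"
    using finite_distinct_list[of "A 0"] finI by (auto simp: A_def)
  \<comment> \<open>Surplus cops are parked on an arbitrary vertex to make their number exactly
    \<open>k\<close>; \<open>S 0\<close> contains every robber start.\<close>
  define C0 where "C0 = xs @ replicate (k - length xs) v0"
  have len: "length C0 = k" using A0 distinct_card[OF xs(2)] xs(1) by (simp add: C0_def)
  have C0: "set C0 \<subseteq> verts G" "A 0 \<subseteq> set C0"
    using xs I v0 by (auto simp: C0_def A_def)
  have "cops_win G (length C0)"
    by (rule cops_win_if_win_from[OF C0(1)])
       (rule sweep[OF len C0(1), of 0], use C0 in \<open>auto simp: S_def\<close>)
  then show ?thesis by (simp add: len)
qed

end

section \<open>Independent sets\<close>

context graph
begin

lemma independent_set_finite: "finite {T. independent_set G T}"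
  by (rule finite_subset[of _ "Pow (verts G)"]) (auto simp: independent_set_def)

lemma card_le_independence_number:
  assumes "independent_set G T"
  shows "card T \<le> independence_number G"
proof -
  have "{card T | T. independent_set G T} = card ` {T. independent_set G T}" by auto
  then show ?thesis unfolding independence_number_def
    using assms independent_set_finite by (intro Max_ge) auto
qed

text \<open>Take an inclusion-maximal independent superset: a vertex it did not dominate could be
  added, as the graph has no loops.\<close>

lemma independent_set_extend:
  assumes "independent_set G X"
  obtains I where "independent_set G I" "X \<subseteq> I"
    "\<And>v. v \<in> verts G \<Longrightarrow> \<exists>a\<in>I. legal_move G a v"
proof -
  have "finite {T. independent_set G T \<and> X \<subseteq> T}"
    using independent_set_finite by (rule rev_finite_subset) auto
  from finite_has_maximal2[OF this, of X] assms obtain I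
    where I: "independent_set G I" "X \<subseteq> I"
      and max: "\<And>T. independent_set G T \<Longrightarrow> X \<subseteq> T \<Longrightarrow> I \<subseteq> T \<Longrightarrow> I = T" by auto
  have "\<exists>a\<in>I. legal_move G a v" if v: "v \<in> verts G" for v
  proof (rule ccontr)
    assume no: "\<not> ?thesis"
    then have "v \<notin> I" using v legal_move_refl by blast
    moreover have "\<not> v \<rightarrow> a \<and> \<not> a \<rightarrow> v" if "a \<in> I" for a
      using no that v I(1) sym_arcs
      by (auto simp: legal_move_iff independent_set_def symmetric_def sym_def)
    then have "independent_set G (insert v I)"
      using I(1) v adj_not_same by (auto simp: independent_set_def)
    ultimately show False using max[of "insert v I"] I(2) by blast
  qed
  with I show thesis by (rule that)
qed

text \<open>The first conclusion ensures that the natural-number subtraction in the second loses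
  nothing.\<close>

lemma cops_win_layers:
  fixes f :: "'a \<Rightarrow> nat"
  assumes sc: "strongly_connected G"
    and layer: "\<And>u v. u \<rightarrow> v \<Longrightarrow> f v \<le> Suc (f u)"
    and onto: "{..D} \<subseteq> f ` verts G"
  shows "D div 2 + 1 \<le> independence_number G"
    and "cops_win G (independence_number G - (D div 2 - 1))"
proof -
  have "\<forall>i\<in>{..D div 2}. \<exists>v\<in>verts G. f v = 2 * i"
  proof
    fix i assume "i \<in> {..D div 2}"
    then have "2 * i \<in> {..D}" by auto
    then show "\<exists>v\<in>verts G. f v = 2 * i" using onto by (metis image_iff subset_iff)
  qed
  then obtain w where w: "\<And>i. i \<le> D div 2 \<Longrightarrow> w i \<in> verts G \<and> f (w i) = 2 * i"
    by (metis atMost_iff)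
  define X where "X = w ` {..D div 2}"
  have inj: "inj_on w {..D div 2}"
    using w by (intro inj_onI) (metis atMost_iff mult_cancel1 zero_neq_numeral)
  have cardX: "card X = D div 2 + 1" unfolding X_def by (simp add: card_image[OF inj])
  have "\<not> w i \<rightarrow> w j" if ij: "i \<le> D div 2" "j \<le> D div 2" for i j
  proof
    assume e: "w i \<rightarrow> w j"
    then have "w j \<rightarrow> w i" using sym_arcs by (auto simp: symmetric_def sym_def)
    \<comment> \<open>Adjacent layers differ by at most one, and two even numbers that close are
      equal.\<close>
    from layer[OF e] layer[OF this] have "i = j" using w ij by simp
    with e show False using adj_not_same by blast
  qed
  then have "independent_set G X" using w by (auto simp: independent_set_def X_def)
  then obtain I where I: "independent_set G I" "X \<subseteq> I"
    and dom: "\<And>v. v \<in> verts G \<Longrightarrow> \<exists>a\<in>I. legal_move G a v" by (rule independent_set_extend) blast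
  have Iv: "I \<subseteq> verts G" using I(1) by (simp add: independent_set_def)
  then have finI: "finite I" using finite_verts finite_subset by blast
  have Ile: "card I \<le> independence_number G" by (rule card_le_independence_number[OF I(1)])
  show "D div 2 + 1 \<le> independence_number G"
    using card_mono[OF finI I(2)] Ile cardX by simp
  have "card {x \<in> I. j \<le> f x \<and> f x \<le> j + 3} \<le> independence_number G - (D div 2 - 1)" for j
  proof -
    let ?W = "{x \<in> I. j \<le> f x \<and> f x \<le> j + 3}"
    \<comment> \<open>Four consecutive integers contain exactly two even ones, the first being twice
      the ceiling of \<open>j / 2\<close>. An index beyond \<open>D div 2\<close> does no harm,
      since only the size of the image matters.\<close>
    have "X \<inter> ?W \<subseteq> w ` {(j + 1) div 2, (j + 1) div 2 + 1}"
    proof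
      fix x assume x: "x \<in> X \<inter> ?W"
      then obtain i where i: "i \<le> D div 2" "x = w i" by (auto simp: X_def)
      with x w have "j \<le> 2 * i" "2 * i \<le> j + 3" by auto
      then have "i = (j + 1) div 2 \<or> i = (j + 1) div 2 + 1" by linarith
      with i show "x \<in> w ` {(j + 1) div 2, (j + 1) div 2 + 1}" by auto
    qed
    then have "card (X \<inter> ?W) \<le> card (w ` {(j + 1) div 2, (j + 1) div 2 + 1})"
      by (intro card_mono) auto
    also have "\<dots> \<le> card {(j + 1) div 2, (j + 1) div 2 + 1}" by (rule card_image_le) auto
    also have "\<dots> \<le> 2" by simp
    finally have two: "card (X \<inter> ?W) \<le> 2" .
    have finX: "finite X" by (simp add: X_def)
    \<comment> \<open>At least \<open>card X - 2\<close> elements of \<open>X\<close>, hence of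
      \<open>I\<close>, lie outside the window; subtracting them from \<open>card I\<close> bounds
      \<open>card ?W\<close>.\<close>
    have "card X = card (X \<inter> ?W) + card (X - ?W)"
      using card_Int_Diff[OF finX] .
    moreover have "card (X - ?W) \<le> card (I - ?W)"
      using I(2) finI by (intro card_mono) auto
    moreover have "card I = card ?W + card (I - ?W)"
      using card_Int_Diff[OF finI, of ?W] by (simp add: Int_absorb1)
    ultimately show ?thesis using two cardX Ile by linarith
  qed
  from cops_win_sweep[OF sc layer Iv dom this]
  show "cops_win G (independence_number G - (D div 2 - 1))" by blast
qed

end

section \<open>Distance layers\<close>

context wf_digraph
begin

text \<open>A natural-number copy of the distance, with the same minimum as in
  \<open>graph_dist_least\<close>, so that it can number the layers.\<close>

definition walk_dist :: "'a \<Rightarrow> 'a \<Rightarrow> nat" where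
  "walk_dist u v = (LEAST n. \<exists>p. awalk u p v \<and> length p = n)"

lemma walk_dist_le: "awalk u p v \<Longrightarrow> walk_dist u v \<le> length p"
  unfolding walk_dist_def by (rule Least_le) blast

lemma walk_dist_attained:
  assumes "u \<rightarrow>\<^sup>* v"
  obtains p where "awalk u p v" "length p = walk_dist u v"
proof -
  have "\<exists>n p. awalk u p v \<and> length p = n" using assms by (auto simp: reachable_awalk)
  from LeastI_ex[OF this] show thesis using that unfolding walk_dist_def by blast
qed

lemma walk_dist_adj:
  assumes "u \<rightarrow>\<^sup>* v" "v \<rightarrow> w"
  shows "walk_dist u w \<le> Suc (walk_dist u v)"
proof -
  obtain p where p: "awalk u p v" "length p = walk_dist u v" using assms(1) by (rule walk_dist_attained)
  obtain e where "e \<in> arcs G" "tail G e = v" "head G e = w" using assms(2) by auto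
  then have "awalk v [e] w" by (auto simp: awalk_Cons_iff awalk_Nil_iff)
  with p(1) have "awalk u (p @ [e]) w" by (rule awalk_appendI)
  from walk_dist_le[OF this] p(2) show ?thesis by simp
qed

text \<open>A prefix of a shortest walk is itself shortest, so the vertex reached after
  \<open>i\<close> steps has distance \<open>i\<close>.\<close>

lemma walk_dist_onto:
  assumes "u \<rightarrow>\<^sup>* v" "i \<le> walk_dist u v"
  shows "\<exists>x\<in>verts G. walk_dist u x = i"
proof -
  obtain p where p: "awalk u p v" "length p = walk_dist u v" using assms(1) by (rule walk_dist_attained)
  define x where "x = awlast u (take i p)"
  have "awalk u (take i p @ drop i p) v" using p(1) by simp
  then have px: "awalk u (take i p) x" and qx: "awalk x (drop i p) v"
    unfolding awalk_append_iff x_def by auto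
  from px have reach: "u \<rightarrow>\<^sup>* x" by (auto simp: reachable_awalk)
  then obtain q where q: "awalk u q x" "length q = walk_dist u x" by (rule walk_dist_attained)
  \<comment> \<open>Splicing a shortest walk to \<open>x\<close> with the rest of \<open>p\<close>
    cannot beat the shortest walk to \<open>v\<close>.\<close>
  have "walk_dist u v \<le> walk_dist u x + (walk_dist u v - i)"
    using walk_dist_le[OF awalk_appendI[OF q(1) qx]] q(2) p(2) by simp
  moreover have "walk_dist u x \<le> i" using walk_dist_le[OF px] p(2) assms(2) by simp
  ultimately have "walk_dist u x = i" using assms(2) by linarith
  then show ?thesis using reach by (auto dest: reachable_in_verts)
qed

end

section \<open>The diameter and the final bound\<close>

lemma (in fin_digraph) graph_diameter_attained:
  assumes sc: "strongly_connected G"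
  obtains u v where "u \<in> verts G" "v \<in> verts G" "graph_diameter G = ereal (real (walk_dist u v))"
proof -
  let ?M = "{graph_dist G u v | u v. u \<in> verts G \<and> v \<in> verts G}"
  have "?M = (\<lambda>(u, v). graph_dist G u v) ` (verts G \<times> verts G)" by auto
  then have "finite ?M" by simp
  moreover have "verts G \<noteq> {}" using sc by (simp add: strongly_connected_def)
  then have "?M \<noteq> {}" by blast
  ultimately have "Max ?M \<in> ?M" by (rule Max_in)
  then obtain u v where uv: "u \<in> verts G" "v \<in> verts G" "graph_diameter G = graph_dist G u v"
    unfolding graph_diameter_def by blast
  then have "u \<rightarrow>\<^sup>* v" using sc by (auto simp: strongly_connected_def)
  from graph_dist_least[OF this] uv show thesis using that unfolding walk_dist_def by metis
qed

theorem theorem3: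
  fixes G :: "('a, 'b) pre_digraph"
  assumes "graph G"
    and "Digraph_Component.connected G"
  shows "int (cop_number G) \<le>
    int (independence_number G) - \<lfloor>(real_of_ereal (graph_diameter G) - 3) / 2\<rfloor>"
proof -
  interpret graph G by fact
  have sc: "strongly_connected G"
    using sym_arcs assms(2) by (rule symmetric_connected_imp_strongly_connected)
  then obtain u v where uv: "u \<in> verts G" "v \<in> verts G"
    and diam: "graph_diameter G = ereal (real (walk_dist u v))" by (rule graph_diameter_attained)
  define D where "D = walk_dist u v"
  have reach: "u \<rightarrow>\<^sup>*\<^bsub>G\<^esub> x" if "x \<in> verts G" for x
    using sc uv(1) that by (auto simp: strongly_connected_def)
  have layer: "walk_dist u y \<le> Suc (walk_dist u x)" if "x \<rightarrow>\<^bsub>G\<^esub> y" for x y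
    using that by (intro walk_dist_adj reach) auto
  have onto: "{..D} \<subseteq> walk_dist u ` verts G"
    using walk_dist_onto[OF reach[OF uv(2)]] unfolding D_def by force
  note win = cops_win_layers[OF sc layer onto]
  have "cop_number G \<le> independence_number G - (D div 2 - 1)"
    unfolding cop_number_def using win(2) by (rule Least_le)
  moreover have "\<lfloor>(real_of_ereal (graph_diameter G) - 3) / 2\<rfloor> = (int D - 3) div 2"
    using floor_divide_of_int_eq[of "int D - 3" 2, where 'a = real] by (simp add: diam D_def)
  \<comment> \<open>The floor never exceeds the truncated \<open>D div 2 - 1\<close>; for
    \<open>D < 3\<close> it is negative.\<close>
  ultimately show ?thesis using win(1) by linarith
qed

end
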